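(* If $\Omega$ is a quiver, $x_0,x_1,\dots$ is a tail of $\Omega$, and $V$ is a locally finite-dimensional indecomposable representation of $\Omega$ such that $V(x_0)\neq0$, then it cannot be that $\dim V(x_n)<\dim V(x_{n+1})$ for any $n\ge0$.
   Context: Fix an arbitrary field $\mathbb{F}$. A quiver $\Omega=(\Omega_0,\Omega_1)$ is a (possibly infinite) set $\Omega_0$ of vertices and a set $\Omega_1$ of ordered pairs of vertices called arrows; an arrow $a=(x,y)$ is said to point $x\to y$, and an arrow is between $x$ and $y$ if it is $(x,y)$ or $(y,x)$. A representation $V$ of $\Omega$ assigns an $\mathbb{F}$-vector space $V(x)$ to each vertex $x$ and a linear map $V(a):V(x)\to V(y)$ to each arrow $a:x\to y$; it is locally finite-dimensional if every $V(x)$ is finite-dimensional. A subrepresentation is a choice of subspaces $W(x)\subseteq V(x)$ with $V(a)(W(x))\subseteq W(y)$ for all arrows $a:x\to y$; direct sums are taken vertexwise; $V$ is indecomposable if it is nonzero and not the direct sum of two nonzero subrepresentations. An infinite journey in $\Omega$ is a quiver morphism, injective on vertices, to $\Omega$ from a quiver whose underlying graph is the one-sided infinite path $A_\infty$ (with arbitrary orientation of the arrows); its vertices are listed as $x_0,x_1,x_2,\dots$ in order along the path. A tail of $\Omega$ is an infinite journey with vertices $x_0,x_1,\dots$ such that in $\Omega$ there is exactly one arrow between $x_i$ and $x_{i+1}$ and there are no arrows between $x_i$ and $x_j$ for $j\neq i+1,i-1$.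
   Formalization: The definition of a tail is strengthened: for i ≥ 1 there are also no arrows between x_i and vertices outside the journey; without this, a D_4-type representation centred at x_1 has dim V(x_0)=1 < 2=dim V(x_1) and refutes the claim. *)

theory Defs
  imports "Jordan_Normal_Form.Missing_VectorSpace" "Graph_Theory.Pair_Digraph"
begin

text \<open>A quiver is a set \<open>pverts\<close> of vertices, possibly infinite, with a set \<open>parcs\<close> of ordered
  pairs of vertices, loops allowed: the structure described by the locale
  \<^locale>\<open>pair_wf_digraph\<close>.\<close>

type_synonym 'q quiver = "'q pair_pre_digraph"

abbreviation quiver :: "'q quiver \<Rightarrow> bool" where
  "quiver \<equiv> pair_wf_digraph"

definition arrows_between :: "'q quiver \<Rightarrow> 'q \<Rightarrow> 'q \<Rightarrow> ('q \<times> 'q) set" where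
  "arrows_between \<Omega> x y = parcs \<Omega> \<inter> {(x, y), (y, x)}"

text \<open>There is at most one arrow \<open>x \<rightarrow> y\<close>, so a morphism is determined by its effect on vertices.\<close>

definition quiver_morphism :: "'p quiver \<Rightarrow> 'q quiver \<Rightarrow> ('p \<Rightarrow> 'q) \<Rightarrow> bool" where
  "quiver_morphism P \<Omega> f \<longleftrightarrow>
     (\<forall>i\<in>pverts P. f i \<in> pverts \<Omega>) \<and> (\<forall>(i, j)\<in>parcs P. (f i, f j) \<in> parcs \<Omega>)"

text \<open>The quivers obtained by orienting the one-sided infinite path \<open>0 - 1 - 2 - \<dots>\<close>\<close>

definition A_infinity_quiver :: "nat quiver \<Rightarrow> bool" where
  "A_infinity_quiver P \<longleftrightarrow> pverts P = UNIV \<and>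
     (\<forall>i j. card (arrows_between P i j) = (if j = i + 1 \<or> i = j + 1 then 1 else 0))"

text \<open>A journey is given by its list of vertices \<open>x 0, x 1, \<dots>\<close>\<close>

definition infinite_journey :: "'q quiver \<Rightarrow> (nat \<Rightarrow> 'q) \<Rightarrow> bool" where
  "infinite_journey \<Omega> x \<longleftrightarrow> (\<exists>P. A_infinity_quiver P \<and> quiver_morphism P \<Omega> x \<and> inj x)"

text \<open>The case \<open>j = i\<close> of the third clause excludes loops. The last clause says that a tail is
  attached to the rest of the quiver at most through \<open>x 0\<close>. It cannot be dropped: otherwise
  further arrows could attach vertices outside the journey to, say, \<open>x 1\<close>, and indecomposable
  representations of type \<open>D\<^sub>4\<close> centred at \<open>x 1\<close> have dimension 1 at \<open>x 0\<close> and 2 at \<open>x 1\<close>.\<close>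

definition quiver_tail :: "'q quiver \<Rightarrow> (nat \<Rightarrow> 'q) \<Rightarrow> bool" where
  "quiver_tail \<Omega> x \<longleftrightarrow> infinite_journey \<Omega> x \<and>
     (\<forall>i. card (arrows_between \<Omega> (x i) (x (i + 1))) = 1) \<and>
     (\<forall>i j. j \<noteq> i + 1 \<and> i \<noteq> j + 1 \<longrightarrow> arrows_between \<Omega> (x i) (x j) = {}) \<and>
     (\<forall>i\<ge>1. \<forall>y\<in>pverts \<Omega> - range x. arrows_between \<Omega> (x i) y = {})"

text \<open>Each vertex carries its own vector space, with its own operations; only the type of vectors
  is shared.\<close>

record ('q, 'f, 'v) representation =
  rspace :: "'q \<Rightarrow> ('f, 'v) module"
  rmap :: "'q \<times> 'q \<Rightarrow> 'v \<Rightarrow> 'v"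

locale quiver_representation =
  pair_wf_digraph \<Omega> + K?: field K
  for K :: "('f, 'k) ring_scheme" (structure)
    and \<Omega> :: "'q quiver"
    and V :: "('q, 'f, 'v) representation" +
  assumes vectorspace_rspace: "x \<in> pverts \<Omega> \<Longrightarrow> vectorspace K (rspace V x)"
    and linear_map_rmap:
      "(x, y) \<in> parcs \<Omega> \<Longrightarrow> linear_map K (rspace V x) (rspace V y) (rmap V (x, y))"

definition locally_fin_dim ::
    "('f, 'k) ring_scheme \<Rightarrow> 'q quiver \<Rightarrow> ('q, 'f, 'v) representation \<Rightarrow> bool" where
  "locally_fin_dim K \<Omega> V \<longleftrightarrow> (\<forall>x\<in>pverts \<Omega>. vectorspace.fin_dim K (rspace V x))"

definition subrepresentation ::
    "('f, 'k) ring_scheme \<Rightarrow> 'q quiver \<Rightarrow> ('q, 'f, 'v) representation \<Rightarrow> ('q \<Rightarrow> 'v set) \<Rightarrow> bool" where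
  "subrepresentation K \<Omega> V W \<longleftrightarrow>
     (\<forall>x\<in>pverts \<Omega>. VectorSpace.subspace K (W x) (rspace V x)) \<and>
     (\<forall>(x, y)\<in>parcs \<Omega>. rmap V (x, y) ` W x \<subseteq> W y)"

definition nonzero_on ::
    "'q quiver \<Rightarrow> ('q, 'f, 'v) representation \<Rightarrow> ('q \<Rightarrow> 'v set) \<Rightarrow> bool" where
  "nonzero_on \<Omega> V W \<longleftrightarrow> (\<exists>x\<in>pverts \<Omega>. W x \<noteq> {\<zero>\<^bsub>rspace V x\<^esub>})"

definition is_direct_sum ::
    "'q quiver \<Rightarrow> ('q, 'f, 'v) representation \<Rightarrow> ('q \<Rightarrow> 'v set) \<Rightarrow> ('q \<Rightarrow> 'v set) \<Rightarrow> bool" where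
  "is_direct_sum \<Omega> V U W \<longleftrightarrow>
     (\<forall>x\<in>pverts \<Omega>. U x \<inter> W x = {\<zero>\<^bsub>rspace V x\<^esub>} \<and>
        module.submodule_sum (rspace V x) (U x) (W x) = carrier (rspace V x))"

definition indecomposable ::
    "('f, 'k) ring_scheme \<Rightarrow> 'q quiver \<Rightarrow> ('q, 'f, 'v) representation \<Rightarrow> bool" where
  "indecomposable K \<Omega> V \<longleftrightarrow>
     nonzero_on \<Omega> V (\<lambda>x. carrier (rspace V x)) \<and>
     \<not> (\<exists>U W. subrepresentation K \<Omega> V U \<and> subrepresentation K \<Omega> V W \<and>
          nonzero_on \<Omega> V U \<and> nonzero_on \<Omega> V W \<and> is_direct_sum \<Omega> V U W)"

end

theory Submission
  imports Defs "Jordan_Normal_Form.DL_Rank"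
begin

text \<open>Suppose \<open>dim V(x\<^sub>n) < dim V(x\<^sub>n\<^sub>+\<^sub>1)\<close>. Depending on its direction, the map on the arrow between
  \<open>x\<^sub>n\<close> and \<open>x\<^sub>n\<^sub>+\<^sub>1\<close> has a nonzero kernel in \<open>V(x\<^sub>n\<^sub>+\<^sub>1)\<close> or is not onto it. So \<open>V(x\<^sub>n\<^sub>+\<^sub>1) = A \<oplus> B\<close> with
  \<open>A \<noteq> 0\<close>, where \<open>A\<close> lies in the kernel or \<open>B\<close> contains the image. The subspaces of \<open>V(x\<^sub>k)\<close> obtained
  from \<open>0\<close> and from whole spaces further along the tail by images and preimages form a chain. If
  every member \<open>F\<close> of the chain satisfies \<open>A \<subseteq> F\<close> or \<open>F \<subseteq> B\<close>, the decomposition extends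
  to the next vertex with the same property, hence along the rest of the tail; and by finite
  dimension \<open>A\<close> and \<open>B\<close> can be chosen with this property at \<open>x\<^sub>n\<^sub>+\<^sub>1\<close>. Extending \<open>A\<close> by zero
  and \<open>B\<close> by \<open>V\<close> to all other vertices decomposes \<open>V\<close>; the second summand is nonzero because
  it contains \<open>V(x\<^sub>0)\<close>.\<close>

section \<open>Complements of subspaces\<close>

text \<open>This is the condition of \<open>is_direct_sum\<close> at a single vertex together with
  the subspace conditions, so that a decomposition of a representation can be assembled vertex by
  vertex.\<close>

definition complementary ::
    "('f, 'k) ring_scheme \<Rightarrow> ('f, 'v, 'm) module_scheme \<Rightarrow> 'v set \<Rightarrow> 'v set \<Rightarrow> bool" where
  "complementary K V A B \<longleftrightarrow>
     VectorSpace.subspace K A V \<and> VectorSpace.subspace K B V \<and>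
     A \<inter> B = {\<zero>\<^bsub>V\<^esub>} \<and> module.submodule_sum V A B = carrier V"

context vectorspace
begin

lemma subspaceI:
  assumes "W \<subseteq> carrier V" "\<zero>\<^bsub>V\<^esub> \<in> W"
    and "\<And>v w. v \<in> W \<Longrightarrow> w \<in> W \<Longrightarrow> v \<oplus>\<^bsub>V\<^esub> w \<in> W"
    and "\<And>c v. c \<in> carrier K \<Longrightarrow> v \<in> W \<Longrightarrow> c \<odot>\<^bsub>V\<^esub> v \<in> W"
  shows "VectorSpace.subspace K W V"
  using assms by (intro subspace.intro submodule.intro) (auto intro: vectorspace_axioms module_axioms)

lemma subspaceD:
  assumes "VectorSpace.subspace K W V"
  shows subspace_subset: "W \<subseteq> carrier V"
    and subspace_carrier: "v \<in> W \<Longrightarrow> v \<in> carrier V"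
    and subspace_zero: "\<zero>\<^bsub>V\<^esub> \<in> W"
    and subspace_add: "v \<in> W \<Longrightarrow> w \<in> W \<Longrightarrow> v \<oplus>\<^bsub>V\<^esub> w \<in> W"
    and subspace_smult: "c \<in> carrier K \<Longrightarrow> v \<in> W \<Longrightarrow> c \<odot>\<^bsub>V\<^esub> v \<in> W"
  using assms unfolding VectorSpace.subspace_def submodule_def by auto

lemma subspace_minus:
  assumes "VectorSpace.subspace K W V" "v \<in> W" "w \<in> W"
  shows "v \<ominus>\<^bsub>V\<^esub> w \<in> W"
proof -
  have "v \<oplus>\<^bsub>V\<^esub> (\<ominus>\<^bsub>K\<^esub> \<one>\<^bsub>K\<^esub>) \<odot>\<^bsub>V\<^esub> w \<in> W"
    using assms by (intro subspace_add subspace_smult) auto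
  moreover have "(\<ominus>\<^bsub>K\<^esub> \<one>\<^bsub>K\<^esub>) \<odot>\<^bsub>V\<^esub> w = \<ominus>\<^bsub>V\<^esub> w"
    using subspace_carrier[OF assms(1,3)] by (simp add: smult_minus_1)
  ultimately show ?thesis by (simp add: a_minus_def)
qed

lemma add_minus_cancel_left:
  "a \<in> carrier V \<Longrightarrow> b \<in> carrier V \<Longrightarrow> (a \<oplus>\<^bsub>V\<^esub> b) \<ominus>\<^bsub>V\<^esub> a = b"
  by (simp add: a_minus_def M.a_assoc M.a_lcomm[of a b "\<ominus>\<^bsub>V\<^esub> a"] M.r_neg)

lemma add_minus_inverse:
  "a \<in> carrier V \<Longrightarrow> b \<in> carrier V \<Longrightarrow> a \<oplus>\<^bsub>V\<^esub> (b \<ominus>\<^bsub>V\<^esub> a) = b"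
  by (simp add: a_minus_def M.a_assoc M.a_lcomm[of a b "\<ominus>\<^bsub>V\<^esub> a"] M.r_neg)

lemma subspace_zero_set: "VectorSpace.subspace K {\<zero>\<^bsub>V\<^esub>} V"
  by (rule subspaceI) auto

lemma subspace_whole: "VectorSpace.subspace K (carrier V) V"
  by (rule subspaceI) auto

lemma subspace_Int:
  "VectorSpace.subspace K A V \<Longrightarrow> VectorSpace.subspace K B V \<Longrightarrow> VectorSpace.subspace K (A \<inter> B) V"
  by (rule subspaceI) (auto dest: subspaceD)

lemma subspace_Union_chain:
  assumes "C \<noteq> {}" "\<And>F. F \<in> C \<Longrightarrow> VectorSpace.subspace K F V"
    and chain: "\<And>F G. F \<in> C \<Longrightarrow> G \<in> C \<Longrightarrow> F \<subseteq> G \<or> G \<subseteq> F"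
  shows "VectorSpace.subspace K (\<Union>C) V"
proof (rule subspaceI)
  fix v w assume "v \<in> \<Union>C" "w \<in> \<Union>C"
  then obtain F G where "F \<in> C" "G \<in> C" "v \<in> F" "w \<in> G" by blast
  with chain obtain H where "H \<in> C" "v \<in> H" "w \<in> H" by blast
  then show "v \<oplus>\<^bsub>V\<^esub> w \<in> \<Union>C" using assms(2) subspace_add by blast
next
  show "\<Union>C \<subseteq> carrier V" using assms(2) subspace_subset by blast
  show "\<zero>\<^bsub>V\<^esub> \<in> \<Union>C" using assms(1,2) subspace_zero by blast
  show "c \<odot>\<^bsub>V\<^esub> v \<in> \<Union>C" if "c \<in> carrier K" "v \<in> \<Union>C" for c v
    using that assms(2) subspace_smult by blast
qed

lemma mem_submodule_sum: "v \<in> submodule_sum A B \<longleftrightarrow> (\<exists>a\<in>A. \<exists>b\<in>B. v = a \<oplus>\<^bsub>V\<^esub> b)"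
  by (auto simp: submodule_sum_def)

lemma complementary_split:
  assumes "complementary K V A B" "v \<in> carrier V"
  obtains a b where "a \<in> A" "b \<in> B" "v = a \<oplus>\<^bsub>V\<^esub> b"
proof -
  have "v \<in> submodule_sum A B" using assms by (simp add: complementary_def)
  then show thesis using that by (auto simp: mem_submodule_sum)
qed

lemma complementaryI:
  assumes A: "VectorSpace.subspace K A V" and B: "VectorSpace.subspace K B V"
    and disj: "A \<inter> B \<subseteq> {\<zero>\<^bsub>V\<^esub>}"
    and split: "\<And>v. v \<in> carrier V \<Longrightarrow> \<exists>a\<in>A. \<exists>b\<in>B. v = a \<oplus>\<^bsub>V\<^esub> b"
  shows "complementary K V A B"
proof -
  have "A \<inter> B = {\<zero>\<^bsub>V\<^esub>}" using disj A B by (auto dest: subspace_zero)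
  moreover have "submodule_sum A B = carrier V"
    using split subspace_carrier[OF A] subspace_carrier[OF B] by (auto simp: mem_submodule_sum)
  ultimately show ?thesis using A B by (simp add: complementary_def)
qed

lemma complementary_zero_whole: "complementary K V {\<zero>\<^bsub>V\<^esub>} (carrier V)"
  by (rule complementaryI) (auto simp: subspace_zero_set subspace_whole)

lemma subspace_insert_vector:
  assumes U: "VectorSpace.subspace K U V" and v: "v \<in> carrier V"
  shows "VectorSpace.subspace K {u \<oplus>\<^bsub>V\<^esub> c \<odot>\<^bsub>V\<^esub> v |u c. u \<in> U \<and> c \<in> carrier K} V"
    (is "VectorSpace.subspace K ?S V")
proof (rule subspaceI)
  show "?S \<subseteq> carrier V" using subspace_carrier[OF U] v by auto
  have "\<zero>\<^bsub>V\<^esub> = \<zero>\<^bsub>V\<^esub> \<oplus>\<^bsub>V\<^esub> \<zero>\<^bsub>K\<^esub> \<odot>\<^bsub>V\<^esub> v" using v by simp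
  then show "\<zero>\<^bsub>V\<^esub> \<in> ?S" using subspace_zero[OF U] by blast
next
  fix x y assume "x \<in> ?S" "y \<in> ?S"
  then obtain u c u' c' where *: "u \<in> U" "c \<in> carrier K" "x = u \<oplus>\<^bsub>V\<^esub> c \<odot>\<^bsub>V\<^esub> v"
    "u' \<in> U" "c' \<in> carrier K" "y = u' \<oplus>\<^bsub>V\<^esub> c' \<odot>\<^bsub>V\<^esub> v" by blast
  then have "x \<oplus>\<^bsub>V\<^esub> y = (u \<oplus>\<^bsub>V\<^esub> u') \<oplus>\<^bsub>V\<^esub> (c \<oplus>\<^bsub>K\<^esub> c') \<odot>\<^bsub>V\<^esub> v"
    using v subspace_carrier[OF U] by (simp add: smult_l_distr a_ac)
  then show "x \<oplus>\<^bsub>V\<^esub> y \<in> ?S" using * subspace_add[OF U] by blast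
next
  fix d x assume d: "d \<in> carrier K" and "x \<in> ?S"
  then obtain u c where *: "u \<in> U" "c \<in> carrier K" "x = u \<oplus>\<^bsub>V\<^esub> c \<odot>\<^bsub>V\<^esub> v" by blast
  then have "d \<odot>\<^bsub>V\<^esub> x = d \<odot>\<^bsub>V\<^esub> u \<oplus>\<^bsub>V\<^esub> (d \<otimes>\<^bsub>K\<^esub> c) \<odot>\<^bsub>V\<^esub> v"
    using v d subspace_carrier[OF U] by (simp add: smult_r_distr smult_assoc1)
  then show "d \<odot>\<^bsub>V\<^esub> x \<in> ?S" using * d subspace_smult[OF U] by blast
qed

text \<open>Zorn gives a maximal \<open>B\<close> among the subspaces that contain \<open>S\<close>
  and meet \<open>A\<close> trivially. A vector outside the sum of \<open>A\<close> and
  \<open>B\<close> could be adjoined to \<open>B\<close>, against maximality.\<close>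

lemma complement_extending:
  assumes A: "VectorSpace.subspace K A V" and S: "VectorSpace.subspace K S V"
    and disj: "A \<inter> S \<subseteq> {\<zero>\<^bsub>V\<^esub>}"
  obtains B where "S \<subseteq> B" "complementary K V A B"
proof -
  let ?Z = "{U. VectorSpace.subspace K U V \<and> S \<subseteq> U \<and> A \<inter> U \<subseteq> {\<zero>\<^bsub>V\<^esub>}}"
  have "\<exists>M\<in>?Z. \<forall>X\<in>?Z. M \<subseteq> X \<longrightarrow> X = M"
  proof (rule subset_Zorn_nonempty)
    show "?Z \<noteq> {}" using S disj by blast
    fix C assume ne: "C \<noteq> {}" and C: "subset.chain ?Z C"
    then have sub: "C \<subseteq> ?Z" and "\<And>F G. F \<in> C \<Longrightarrow> G \<in> C \<Longrightarrow> F \<subseteq> G \<or> G \<subseteq> F"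
      by (auto simp: subset_chain_def)
    then have "VectorSpace.subspace K (\<Union>C) V" using ne by (intro subspace_Union_chain) auto
    then show "\<Union>C \<in> ?Z" using sub ne by blast
  qed
  then obtain B where "B \<in> ?Z" and max: "\<forall>X\<in>?Z. B \<subseteq> X \<longrightarrow> X = B" ..
  then have B: "VectorSpace.subspace K B V" and SB: "S \<subseteq> B" and AB: "A \<inter> B \<subseteq> {\<zero>\<^bsub>V\<^esub>}"
    by auto
  have "\<exists>a\<in>A. \<exists>b\<in>B. v = a \<oplus>\<^bsub>V\<^esub> b" if v: "v \<in> carrier V" for v
  proof (rule ccontr)
    assume no: "\<not> ?thesis"
    let ?X = "{u \<oplus>\<^bsub>V\<^esub> c \<odot>\<^bsub>V\<^esub> v |u c. u \<in> B \<and> c \<in> carrier K}"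
    have X: "VectorSpace.subspace K ?X V" by (rule subspace_insert_vector[OF B v])
    have BX: "B \<subseteq> ?X"
    proof
      fix b assume b: "b \<in> B"
      then have "b = b \<oplus>\<^bsub>V\<^esub> \<zero>\<^bsub>K\<^esub> \<odot>\<^bsub>V\<^esub> v" using v subspace_carrier[OF B] by simp
      then show "b \<in> ?X" using b by blast
    qed
    have "A \<inter> ?X \<subseteq> {\<zero>\<^bsub>V\<^esub>}"
    proof
      fix a assume "a \<in> A \<inter> ?X"
      then obtain u c where a: "a \<in> A" "u \<in> B" "c \<in> carrier K" "a = u \<oplus>\<^bsub>V\<^esub> c \<odot>\<^bsub>V\<^esub> v" by blast
      note car = subspace_carrier[OF A a(1)] subspace_carrier[OF B a(2)]
      \<comment> \<open>Otherwise dividing by \<open>c\<close> would express \<open>v\<close> as an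
        element of \<open>A\<close> plus an element of \<open>B\<close>.\<close>
      have "c = \<zero>\<^bsub>K\<^esub>"
      proof (rule ccontr)
        assume "c \<noteq> \<zero>\<^bsub>K\<^esub>"
        then have i: "inv\<^bsub>K\<^esub> c \<in> carrier K" "inv\<^bsub>K\<^esub> c \<otimes>\<^bsub>K\<^esub> c = \<one>\<^bsub>K\<^esub>"
          using a(3) by (auto simp: field_Units)
        have "c \<odot>\<^bsub>V\<^esub> v = a \<oplus>\<^bsub>V\<^esub> (\<zero>\<^bsub>V\<^esub> \<ominus>\<^bsub>V\<^esub> u)"
          using a car v by (simp add: a_minus_def M.add.m_assoc M.add.m_comm M.add.m_lcomm M.r_neg M.r_neg1 M.r_neg2)
        then have "inv\<^bsub>K\<^esub> c \<odot>\<^bsub>V\<^esub> (c \<odot>\<^bsub>V\<^esub> v)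
            = inv\<^bsub>K\<^esub> c \<odot>\<^bsub>V\<^esub> a \<oplus>\<^bsub>V\<^esub> inv\<^bsub>K\<^esub> c \<odot>\<^bsub>V\<^esub> (\<zero>\<^bsub>V\<^esub> \<ominus>\<^bsub>V\<^esub> u)"
          using i car by (simp add: smult_r_distr)
        moreover have "inv\<^bsub>K\<^esub> c \<odot>\<^bsub>V\<^esub> (c \<odot>\<^bsub>V\<^esub> v) = v"
          using i v a(3) by (simp flip: smult_assoc1)
        moreover have "inv\<^bsub>K\<^esub> c \<odot>\<^bsub>V\<^esub> a \<in> A" using i a A by (simp add: subspace_smult)
        moreover have "inv\<^bsub>K\<^esub> c \<odot>\<^bsub>V\<^esub> (\<zero>\<^bsub>V\<^esub> \<ominus>\<^bsub>V\<^esub> u) \<in> B"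
          using i a B by (simp add: subspace_smult subspace_minus subspace_zero)
        ultimately show False using no by metis
      qed
      then have "a = u" using a car v by simp
      then show "a \<in> {\<zero>\<^bsub>V\<^esub>}" using a AB by blast
    qed
    then have XB: "?X = B" using X BX SB by (intro max[rule_format]) auto
    have "v = \<zero>\<^bsub>V\<^esub> \<oplus>\<^bsub>V\<^esub> \<one>\<^bsub>K\<^esub> \<odot>\<^bsub>V\<^esub> v" using v by simp
    moreover have "\<one>\<^bsub>K\<^esub> \<in> carrier K" by simp
    ultimately have "v \<in> ?X" using subspace_zero[OF B] by blast
    then have "v \<in> B" using XB by simp
    moreover have "v = \<zero>\<^bsub>V\<^esub> \<oplus>\<^bsub>V\<^esub> v" using v by simp
    ultimately show False using no subspace_zero[OF A] by blast
  qed
  then have "complementary K V A B" using A B AB by (intro complementaryI) auto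
  then show thesis using SB that by blast
qed

text \<open>Modular law: a complement of \<open>S\<close> in the whole space is cut down to
  \<open>G\<close>. The component of \<open>g\<close> in that complement differs from
  \<open>g\<close> by an element of \<open>S\<close>, hence stays in \<open>G\<close>.\<close>

lemma relative_complement:
  assumes S: "VectorSpace.subspace K S V" and G: "VectorSpace.subspace K G V" and "S \<subseteq> G"
  obtains A where "VectorSpace.subspace K A V" "A \<subseteq> G" "A \<inter> S = {\<zero>\<^bsub>V\<^esub>}"
    "\<forall>g\<in>G. \<exists>s\<in>S. \<exists>a\<in>A. g = s \<oplus>\<^bsub>V\<^esub> a"
proof -
  obtain C where C: "complementary K V S C"
    using complement_extending[OF S subspace_zero_set] by auto
  then have Csub: "VectorSpace.subspace K C V" and SC: "S \<inter> C = {\<zero>\<^bsub>V\<^esub>}"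
    by (auto simp: complementary_def)
  have "\<exists>s\<in>S. \<exists>a\<in>C \<inter> G. g = s \<oplus>\<^bsub>V\<^esub> a" if g: "g \<in> G" for g
  proof -
    obtain s a where sa: "s \<in> S" "a \<in> C" "g = s \<oplus>\<^bsub>V\<^esub> a"
      using complementary_split[OF C] subspace_carrier[OF G g] by metis
    have "g \<ominus>\<^bsub>V\<^esub> s = a"
      using sa subspace_carrier[OF S] subspace_carrier[OF Csub]
      by (simp add: add_minus_cancel_left)
    then have "a \<in> G" using subspace_minus[OF G g] sa assms(3) by blast
    then show ?thesis using sa by blast
  qed
  then show thesis
    using that[of "C \<inter> G"] subspace_Int[OF Csub G] SC subspace_zero[OF G] by blast
qed

section \<open>Dimensions of subspaces\<close>

text \<open>Independent subsets of \<open>X\<close> are independent in \<open>V\<close>, so their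
  size is at most \<open>dim\<close>; a maximal one is a basis of \<open>X\<close>.\<close>

lemma subspace_fin_dim:
  assumes "fin_dim" "VectorSpace.subspace K X V"
  shows "vectorspace.fin_dim K (vs X)"
proof -
  interpret X: vectorspace K "vs X" using assms(2) by (rule subspace_is_vs)
  have bound: "finite S \<and> card S \<le> dim" if "S \<subseteq> X \<and> X.lin_indpt S" for S
  proof -
    have "lin_indpt S" using that span_li_not_depend(2)[OF _ is_module[OF assms(2)], of S] by blast
    moreover have "S \<subseteq> carrier V" using that subspace_subset[OF assms(2)] by blast
    ultimately show ?thesis using li_le_dim[OF assms(1)] by blast
  qed
  have "{} \<subseteq> X \<and> X.lin_indpt {}" by (simp add: X.lin_dep_def)
  from maximal_exists[of "\<lambda>S. S \<subseteq> X \<and> X.lin_indpt S", OF bound this]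
  obtain S where S: "finite S" "maximal S (\<lambda>S. S \<subseteq> X \<and> X.lin_indpt S)" by blast
  have "X.basis S" by (rule X.max_li_is_basis) (use S(2) in simp)
  then show ?thesis using S(1) unfolding X.fin_dim_def X.basis_def by blast
qed

lemma subspace_dim_eq:
  assumes fd: "fin_dim" and X: "VectorSpace.subspace K X V"
    and "dim \<le> vectorspace.dim K (vs X)"
  shows "X = carrier V"
proof -
  interpret X: vectorspace K "vs X" using X by (rule subspace_is_vs)
  obtain b where b: "finite b" "X.basis b"
    using X.finite_basis_exists[OF subspace_fin_dim[OF fd X]] by blast
  then have bX: "b \<subseteq> X" and "X.lin_indpt b" by (simp_all add: X.basis_def)
  then have "lin_indpt b" using span_li_not_depend(2)[OF _ is_module[OF X], of b] by blast
  moreover have "b \<subseteq> carrier V" using bX subspace_subset[OF X] by blast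
  moreover have "dim \<le> card b" using assms(3) X.dim_basis[OF b] by simp
  ultimately have "basis b" using b(1) fd by (intro dim_li_is_basis)
  then have "carrier V = span b" by (simp add: basis_def)
  also have "\<dots> \<subseteq> X" by (rule span_is_subset[OF bX is_module[OF X]])
  finally show ?thesis using subspace_subset[OF X] by blast
qed

text \<open>A member of least dimension works, since a subspace of it of the same dimension is equal
  to it. Within a chain such an \<open>M\<close> is the smallest member of \<open>Q\<close>.\<close>

lemma subspace_minimal:
  assumes fd: "fin_dim" and "F \<in> Q" and Q: "\<And>F. F \<in> Q \<Longrightarrow> VectorSpace.subspace K F V"
  obtains M where "M \<in> Q" "\<And>G. G \<in> Q \<Longrightarrow> G \<subseteq> M \<Longrightarrow> G = M"
proof -
  let ?d = "\<lambda>F. vectorspace.dim K (vs F)"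
  obtain M where M: "M \<in> Q" "\<And>G. G \<in> Q \<Longrightarrow> ?d M \<le> ?d G"
    using ex_has_least_nat[of "\<lambda>F. F \<in> Q" F ?d] assms(2) by blast
  have "G = M" if G: "G \<in> Q" "G \<subseteq> M" for G
  proof -
    interpret M: vectorspace K "vs M" by (rule subspace_is_vs[OF Q[OF M(1)]])
    have "VectorSpace.subspace K G (vs M)"
      by (rule nested_subspaces[OF Q[OF M(1)] Q[OF G(1)] G(2)])
    from M.subspace_dim_eq[OF subspace_fin_dim[OF fd Q[OF M(1)]] this] M(2)[OF G(1)]
    show ?thesis by simp
  qed
  then show thesis using M that by blast
qed

end

section \<open>Decompositions compatible with a chain of subspaces\<close>

text \<open>For complementary \<open>A\<close> and \<open>B\<close> either alternative makes
  \<open>F\<close> the sum of \<open>F \<inter> A\<close> and \<open>F \<inter> B\<close>. Moreover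
  \<open>F\<close> contains \<open>A\<close> or meets it only in zero, so the chain never cuts
  through \<open>A\<close>.\<close>

definition compatible :: "'v set set \<Rightarrow> 'v set \<Rightarrow> 'v set \<Rightarrow> bool" where
  "compatible \<F> A B \<longleftrightarrow> (\<forall>F\<in>\<F>. A \<subseteq> F \<or> F \<subseteq> B)"

definition subspace_chain ::
    "('f, 'k) ring_scheme \<Rightarrow> ('f, 'v, 'm) module_scheme \<Rightarrow> 'v set set \<Rightarrow> bool" where
  "subspace_chain K V \<F> \<longleftrightarrow> (\<forall>F\<in>\<F>. VectorSpace.subspace K F V) \<and> (\<forall>F\<in>\<F>. \<forall>G\<in>\<F>. F \<subseteq> G \<or> G \<subseteq> F)"

context vectorspace
begin

lemma subspace_sum_contains:
  assumes "VectorSpace.subspace K A V" "VectorSpace.subspace K B V"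
  shows "A \<subseteq> submodule_sum A B" "B \<subseteq> submodule_sum A B"
proof -
  show "A \<subseteq> submodule_sum A B" by (rule in_sum_vs[OF assms])
  show "B \<subseteq> submodule_sum A B" unfolding vsum_comm[OF assms] by (rule in_sum_vs[OF assms(2,1)])
qed

text \<open>The hypothesis \<open>disj\<close> says that \<open>A\<close> meets \<open>S + F\<close> trivially for every chain member \<open>F\<close> not
  containing \<open>A\<close>. As the members form a chain, \<open>A\<close> then also meets the sum of \<open>S\<close> with all of them
  trivially, and a complement of \<open>A\<close> containing this sum is compatible.\<close>

lemma compatible_complement:
  assumes A: "VectorSpace.subspace K A V" and S: "VectorSpace.subspace K S V"
    and chain: "subspace_chain K V \<F>" and disj0: "A \<inter> S \<subseteq> {\<zero>\<^bsub>V\<^esub>}"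
    and disj: "\<And>F a s f. F \<in> \<F> \<Longrightarrow> \<not> A \<subseteq> F \<Longrightarrow> a \<in> A \<Longrightarrow> s \<in> S \<Longrightarrow> f \<in> F \<Longrightarrow> a = s \<oplus>\<^bsub>V\<^esub> f \<Longrightarrow> a = \<zero>\<^bsub>V\<^esub>"
  obtains B where "complementary K V A B" "S \<subseteq> B" "compatible \<F> A B"
proof -
  \<comment> \<open>The zero subspace keeps the family nonempty, so that its union is a subspace
    even if every member of the chain contains \<open>A\<close>.\<close>
  let ?C = "insert {\<zero>\<^bsub>V\<^esub>} {F \<in> \<F>. \<not> A \<subseteq> F}"
  have sub: "VectorSpace.subspace K F V" if "F \<in> ?C" for F
    using that chain by (auto simp: subspace_chain_def subspace_zero_set)
  have U: "VectorSpace.subspace K (\<Union>?C) V"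
  proof (rule subspace_Union_chain)
    show "F \<subseteq> G \<or> G \<subseteq> F" if "F \<in> ?C" "G \<in> ?C" for F G
      using that subspace_zero[OF sub[OF that(1)]] subspace_zero[OF sub[OF that(2)]] chain
      by (auto simp: subspace_chain_def)
  qed (use sub in blast)+
  let ?S = "submodule_sum S (\<Union>?C)"
  have "A \<inter> ?S \<subseteq> {\<zero>\<^bsub>V\<^esub>}"
  proof
    fix a assume "a \<in> A \<inter> ?S"
    then obtain s f where a: "a \<in> A" "s \<in> S" "f \<in> \<Union>?C" "a = s \<oplus>\<^bsub>V\<^esub> f"
      by (auto simp only: mem_submodule_sum Int_iff)
    show "a \<in> {\<zero>\<^bsub>V\<^esub>}"
    proof (cases "f = \<zero>\<^bsub>V\<^esub>")
      case True
      then have "a \<in> A \<inter> S" using a subspace_carrier[OF S a(2)] by simp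
      then show ?thesis using disj0 by blast
    next
      case False
      then obtain F where "F \<in> \<F>" "\<not> A \<subseteq> F" "f \<in> F" using a(3) by blast
      from disj[OF this(1,2) a(1,2) this(3) a(4)] show ?thesis by simp
    qed
  qed
  from complement_extending[OF A sum_is_subspace[OF S U] this]
  obtain B where B: "?S \<subseteq> B" "complementary K V A B" .
  have "compatible \<F> A B"
    using subspace_sum_contains(2)[OF S U] B(1) unfolding compatible_def by blast
  moreover have "S \<subseteq> B" using subspace_sum_contains(1)[OF S U] B(1) by blast
  ultimately show thesis using B(2) that by blast
qed

lemma compatible_zero_whole:
  assumes "subspace_chain K V \<F>"
  shows "compatible \<F> {\<zero>\<^bsub>V\<^esub>} (carrier V)"
  unfolding compatible_def
proof
  fix F assume "F \<in> \<F>"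
  then have "VectorSpace.subspace K F V" using assms by (simp add: subspace_chain_def)
  then have "F \<subseteq> carrier V" by (rule subspace_subset)
  then show "{\<zero>\<^bsub>V\<^esub>} \<subseteq> F \<or> F \<subseteq> carrier V" ..
qed

lemma compatible_summand_inside:
  assumes fd: "fin_dim" and chain: "subspace_chain K V \<F>" and whole: "carrier V \<in> \<F>"
    and I: "VectorSpace.subspace K I V" and nz: "I \<noteq> {\<zero>\<^bsub>V\<^esub>}"
  obtains A B where "complementary K V A B" "compatible \<F> A B" "A \<subseteq> I" "A \<noteq> {\<zero>\<^bsub>V\<^esub>}"
proof -
  \<comment> \<open>With \<open>M\<close> the smallest member of the chain meeting \<open>I\<close> nontrivially, take \<open>A = I \<inter> M\<close>.\<close>
  let ?Q = "{F \<in> \<F>. I \<inter> F \<noteq> {\<zero>\<^bsub>V\<^esub>}}"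
  have "I \<inter> carrier V = I" using subspace_subset[OF I] by blast
  then have Q: "carrier V \<in> ?Q" using whole nz by simp
  have sub: "VectorSpace.subspace K F V" if "F \<in> \<F>" for F
    using that chain by (simp add: subspace_chain_def)
  obtain M where M: "M \<in> ?Q" "\<And>G. G \<in> ?Q \<Longrightarrow> G \<subseteq> M \<Longrightarrow> G = M"
    by (rule subspace_minimal[OF fd Q]) (use sub in auto)
  have MF: "M \<in> \<F>" using M(1) by simp
  have A: "VectorSpace.subspace K (I \<inter> M) V" by (rule subspace_Int[OF I sub[OF MF]])
  show thesis
  proof (rule compatible_complement[OF A subspace_zero_set chain])
    fix F a s f
    assume F: "F \<in> \<F>" "\<not> I \<inter> M \<subseteq> F" and a: "a \<in> I \<inter> M" "s \<in> {\<zero>\<^bsub>V\<^esub>}" "f \<in> F" "a = s \<oplus>\<^bsub>V\<^esub> f"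
    \<comment> \<open>In a chain, a member that does not contain \<open>I \<inter> M\<close> lies
      strictly below \<open>M\<close>; by minimality it meets \<open>I\<close> trivially.\<close>
    have "F \<subseteq> M" "F \<noteq> M" using F MF chain unfolding subspace_chain_def by blast+
    then have "I \<inter> F = {\<zero>\<^bsub>V\<^esub>}" using M(2)[of F] F(1) by blast
    moreover have "a = f" using a subspace_carrier[OF sub[OF F(1)] a(3)] by simp
    ultimately show "a = \<zero>\<^bsub>V\<^esub>" using a by blast
  next
    fix B assume "complementary K V (I \<inter> M) B" "compatible \<F> (I \<inter> M) B"
    then show thesis using that[of "I \<inter> M" B] M(1) by blast
  qed blast
qed

lemma compatible_summand_containing:
  assumes fd: "fin_dim" and chain: "subspace_chain K V \<F>" and whole: "carrier V \<in> \<F>"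
    and I: "VectorSpace.subspace K I V" and proper: "I \<noteq> carrier V"
  obtains A B where "complementary K V A B" "compatible \<F> A B" "I \<subseteq> B" "A \<noteq> {\<zero>\<^bsub>V\<^esub>}"
proof -
  \<comment> \<open>With \<open>M\<close> the smallest member of the chain not inside \<open>I\<close>, take for \<open>A\<close> a complement of
    \<open>I \<inter> M\<close> in \<open>M\<close>.\<close>
  let ?Q = "{F \<in> \<F>. \<not> F \<subseteq> I}"
  have Q: "carrier V \<in> ?Q" using whole proper subspace_subset[OF I] by blast
  have sub: "VectorSpace.subspace K F V" if "F \<in> \<F>" for F
    using that chain by (simp add: subspace_chain_def)
  obtain M where M: "M \<in> ?Q" "\<And>G. G \<in> ?Q \<Longrightarrow> G \<subseteq> M \<Longrightarrow> G = M"
    by (rule subspace_minimal[OF fd Q]) (use sub in auto)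
  have MF: "M \<in> \<F>" using M(1) by simp
  obtain A where A: "VectorSpace.subspace K A V" "A \<subseteq> M" "A \<inter> (I \<inter> M) = {\<zero>\<^bsub>V\<^esub>}"
    and split: "\<forall>g\<in>M. \<exists>s\<in>I \<inter> M. \<exists>a\<in>A. g = s \<oplus>\<^bsub>V\<^esub> a"
    by (rule relative_complement[OF subspace_Int[OF I sub[OF MF]] sub[OF MF] Int_lower2])
  have AI: "A \<inter> I \<subseteq> {\<zero>\<^bsub>V\<^esub>}" using A by blast
  have nz: "A \<noteq> {\<zero>\<^bsub>V\<^esub>}"
  proof
    assume A0: "A = {\<zero>\<^bsub>V\<^esub>}"
    have "g \<in> I" if "g \<in> M" for g
      using bspec[OF split that] A0 subspace_carrier[OF I] by auto
    then show False using M(1) by blast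
  qed
  show thesis
  proof (rule compatible_complement[OF A(1) I chain AI])
    fix F a s f
    assume F: "F \<in> \<F>" "\<not> A \<subseteq> F" and a: "a \<in> A" "s \<in> I" "f \<in> F" "a = s \<oplus>\<^bsub>V\<^esub> f"
    \<comment> \<open>Strictly below \<open>M\<close>, the member \<open>F\<close> lies inside
      \<open>I\<close> by minimality, and then so does \<open>s \<oplus> f\<close>.\<close>
    have "F \<subseteq> M" "F \<noteq> M" using F A(2) MF chain unfolding subspace_chain_def by blast+
    then have "F \<subseteq> I" using M(2)[of F] F(1) by blast
    then have "a \<in> I" using a subspace_add[OF I] by blast
    then show "a = \<zero>\<^bsub>V\<^esub>" using a(1) AI by blast
  next
    fix B assume "complementary K V A B" "I \<subseteq> B" "compatible \<F> A B"
    then show thesis using that[of A B] nz by blast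
  qed
qed

end

section \<open>Transport of decompositions along a linear map\<close>

context linear_map
begin

lemma subspace_vimage:
  assumes F: "VectorSpace.subspace K F W"
  shows "VectorSpace.subspace K {v \<in> carrier V. T v \<in> F} V"
  by (rule V.subspaceI) (auto simp: W.subspace_zero[OF F] W.subspace_add[OF F] W.subspace_smult[OF F])

lemma subspace_image:
  assumes F: "VectorSpace.subspace K F V"
  shows "VectorSpace.subspace K (T ` F) W"
proof (rule W.subspaceI)
  show "T ` F \<subseteq> carrier W" using V.subspace_carrier[OF F] by auto
  show "\<zero>\<^bsub>W\<^esub> \<in> T ` F" using V.subspace_zero[OF F] T0_is_0 by (metis image_eqI)
next
  fix v w assume "v \<in> T ` F" "w \<in> T ` F"
  then obtain v' w' where *: "v' \<in> F" "w' \<in> F" "v = T v'" "w = T w'" by blast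
  then have "v \<oplus>\<^bsub>W\<^esub> w = T (v' \<oplus>\<^bsub>V\<^esub> w')" using V.subspace_carrier[OF F] by simp
  then show "v \<oplus>\<^bsub>W\<^esub> w \<in> T ` F" using * V.subspace_add[OF F] by blast
next
  fix c v assume c: "c \<in> carrier K" and "v \<in> T ` F"
  then obtain v' where *: "v' \<in> F" "v = T v'" by blast
  then have "c \<odot>\<^bsub>W\<^esub> v = T (c \<odot>\<^bsub>V\<^esub> v')" using c V.subspace_carrier[OF F] by simp
  then show "c \<odot>\<^bsub>W\<^esub> v \<in> T ` F" using * c V.subspace_smult[OF F] by blast
qed

lemma complementary_push:
  assumes comp: "complementary K V A B"
    and compat: "compatible ((\<lambda>F. {v \<in> carrier V. T v \<in> F}) ` \<F>) A B"
    and chain: "subspace_chain K W \<F>" and zero: "{\<zero>\<^bsub>W\<^esub>} \<in> \<F>"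
  obtains A' B' where "complementary K W A' B'" "compatible \<F> A' B'" "T ` A \<subseteq> A'" "T ` B \<subseteq> B'"
proof -
  have A: "VectorSpace.subspace K A V" and B: "VectorSpace.subspace K B V"
    and AB: "A \<inter> B = {\<zero>\<^bsub>V\<^esub>}" using comp by (auto simp: complementary_def)
  have compat': "A \<subseteq> {v \<in> carrier V. T v \<in> F} \<or> {v \<in> carrier V. T v \<in> F} \<subseteq> B" if "F \<in> \<F>" for F
    using compat that by (simp add: compatible_def)
  show thesis
  proof (cases "A \<subseteq> {v \<in> carrier V. T v \<in> {\<zero>\<^bsub>W\<^esub>}}")
    case True
    then have "T ` A \<subseteq> {\<zero>\<^bsub>W\<^esub>}" by blast
    moreover have "T ` B \<subseteq> carrier W" using V.subspace_carrier[OF B] by auto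
    ultimately show thesis
      using that W.complementary_zero_whole W.compatible_zero_whole[OF chain] by blast
  next
    case False
    \<comment> \<open>The difference of \<open>a\<close> and \<open>b\<close> maps to
      \<open>f\<close>, so it lies in the preimage of \<open>F\<close> and hence in
      \<open>B\<close>. Then \<open>a\<close> lies in both \<open>A\<close> and
      \<open>B\<close>.\<close>
    have key: "T a = \<zero>\<^bsub>W\<^esub>"
      if F: "F \<in> \<F>" "\<not> T ` A \<subseteq> F" and a: "a \<in> A" "b \<in> B" "f \<in> F" "T a = T b \<oplus>\<^bsub>W\<^esub> f" for F a b f
    proof -
      note car = V.subspace_carrier[OF A a(1)] V.subspace_carrier[OF B a(2)]
      have f: "f \<in> carrier W" using chain F(1) a(3) W.subspace_carrier by (auto simp: subspace_chain_def)
      have "T (a \<ominus>\<^bsub>V\<^esub> b) = f"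
        using car a(4) f by (simp add: W.add_minus_cancel_left)
      then have "a \<ominus>\<^bsub>V\<^esub> b \<in> {v \<in> carrier V. T v \<in> F}" using car a(3) by simp
      moreover have "\<not> A \<subseteq> {v \<in> carrier V. T v \<in> F}" using F(2) by blast
      ultimately have "a \<ominus>\<^bsub>V\<^esub> b \<in> B" using compat'[OF F(1)] by blast
      then have "b \<oplus>\<^bsub>V\<^esub> (a \<ominus>\<^bsub>V\<^esub> b) \<in> B" by (rule V.subspace_add[OF B a(2)])
      moreover have "b \<oplus>\<^bsub>V\<^esub> (a \<ominus>\<^bsub>V\<^esub> b) = a"
        using car by (simp add: V.add_minus_inverse)
      ultimately have "a \<in> A \<inter> B" using a(1) by simp
      then show ?thesis using AB by simp
    qed
    have disj0: "T ` A \<inter> T ` B \<subseteq> {\<zero>\<^bsub>W\<^esub>}"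
    proof
      fix w assume "w \<in> T ` A \<inter> T ` B"
      then obtain a b where w: "a \<in> A" "b \<in> B" "w = T a" "w = T b" by blast
      \<comment> \<open>Independence of the two images is the instance of \<open>key\<close> in
        which \<open>F\<close> is the zero subspace and \<open>f\<close> is zero.\<close>
      have "T b \<oplus>\<^bsub>W\<^esub> \<zero>\<^bsub>W\<^esub> = T b" using T_im[OF V.subspace_carrier[OF B w(2)]] by simp
      then have "T a = T b \<oplus>\<^bsub>W\<^esub> \<zero>\<^bsub>W\<^esub>" using w by simp
      moreover have "\<not> T ` A \<subseteq> {\<zero>\<^bsub>W\<^esub>}" using False V.subspace_carrier[OF A] by blast
      ultimately show "w \<in> {\<zero>\<^bsub>W\<^esub>}" using key[OF zero _ w(1,2), of "\<zero>\<^bsub>W\<^esub>"] w(3) by simp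
    qed
    show thesis
    proof (rule W.compatible_complement[OF subspace_image[OF A] subspace_image[OF B] chain disj0])
      fix F a s f
      assume "F \<in> \<F>" "\<not> T ` A \<subseteq> F" "a \<in> T ` A" "s \<in> T ` B" "f \<in> F" "a = s \<oplus>\<^bsub>W\<^esub> f"
      then show "a = \<zero>\<^bsub>W\<^esub>" using key by blast
    next
      fix B' assume "complementary K W (T ` A) B'" "T ` B \<subseteq> B'" "compatible \<F> (T ` A) B'"
      then show thesis using that by blast
    qed
  qed
qed

text \<open>If \<open>A\<close> is not inside the image of \<open>T\<close>, compatibility puts the
  whole image into \<open>B\<close>, and the pair of zero and the whole space serves. Otherwise
  \<open>A\<close> is lifted, and the full preimage of \<open>B\<close> is the other
  summand.\<close>

lemma complementary_pull:
  assumes fd: "V.fin_dim" and comp: "complementary K W A B"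
    and compat: "compatible ((\<lambda>F. T ` F) ` \<F>) A B"
    and chain: "subspace_chain K V \<F>" and whole: "carrier V \<in> \<F>"
  obtains A' B' where "complementary K V A' B'" "compatible \<F> A' B'" "T ` A' \<subseteq> A" "T ` B' \<subseteq> B"
proof -
  have A: "VectorSpace.subspace K A W" and B: "VectorSpace.subspace K B W"
    and AB: "A \<inter> B = {\<zero>\<^bsub>W\<^esub>}" using comp by (auto simp: complementary_def)
  have compat': "A \<subseteq> T ` F \<or> T ` F \<subseteq> B" if "F \<in> \<F>" for F
    using compat that by (simp add: compatible_def)
  show thesis
  proof (cases "A \<subseteq> T ` carrier V")
    case False
    then have "T ` carrier V \<subseteq> B" using compat'[OF whole] by blast
    moreover have "T ` {\<zero>\<^bsub>V\<^esub>} \<subseteq> A" using W.subspace_zero[OF A] by simp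
    ultimately show thesis
      using that V.complementary_zero_whole V.compatible_zero_whole[OF chain] by blast
  next
    case True
    \<comment> \<open>Lift \<open>A\<close> isomorphically into the smallest member of the chain whose image contains \<open>A\<close>.\<close>
    let ?Q = "{F \<in> \<F>. A \<subseteq> T ` F}"
    have Q: "carrier V \<in> ?Q" using whole True by blast
    have sub: "VectorSpace.subspace K F V" if "F \<in> \<F>" for F
      using that chain by (simp add: subspace_chain_def)
    obtain M where M: "M \<in> ?Q" "\<And>G. G \<in> ?Q \<Longrightarrow> G \<subseteq> M \<Longrightarrow> G = M"
      by (rule V.subspace_minimal[OF fd Q]) (use sub in auto)
    have MF: "M \<in> \<F>" using M(1) by simp
    \<comment> \<open>The part \<open>?G\<close> of \<open>M\<close> lying over \<open>A\<close>
      maps onto \<open>A\<close>, so a complement in it of its intersection with the kernel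
      \<open>?N\<close> is a lift of \<open>A\<close>.\<close>
    let ?G = "M \<inter> {v \<in> carrier V. T v \<in> A}" and ?N = "{v \<in> carrier V. T v \<in> {\<zero>\<^bsub>W\<^esub>}}"
    have G: "VectorSpace.subspace K ?G V" by (rule V.subspace_Int[OF sub[OF MF] subspace_vimage[OF A]])
    have N: "VectorSpace.subspace K ?N V" by (rule subspace_vimage[OF W.subspace_zero_set])
    obtain A' where A': "VectorSpace.subspace K A' V" "A' \<subseteq> ?G" "A' \<inter> (?N \<inter> ?G) = {\<zero>\<^bsub>V\<^esub>}"
      and split: "\<forall>g\<in>?G. \<exists>s\<in>?N \<inter> ?G. \<exists>a\<in>A'. g = s \<oplus>\<^bsub>V\<^esub> a"
      by (rule V.relative_complement[OF V.subspace_Int[OF N G] G Int_lower2])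
    let ?B = "{v \<in> carrier V. T v \<in> B}"
    have B': "VectorSpace.subspace K ?B V" by (rule subspace_vimage[OF B])
    have "complementary K V A' ?B"
    proof (rule V.complementaryI[OF A'(1) B'])
      show "A' \<inter> ?B \<subseteq> {\<zero>\<^bsub>V\<^esub>}" using A'(2,3) AB by blast
    next
      fix v assume v: "v \<in> carrier V"
      obtain a b where ab: "a \<in> A" "b \<in> B" "T v = a \<oplus>\<^bsub>W\<^esub> b"
        by (rule W.complementary_split[OF comp T_im[OF v]])
      obtain g where g: "g \<in> M" "a = T g" using M(1) ab(1) by blast
      have gG: "g \<in> ?G" using g ab(1) V.subspace_carrier[OF sub[OF MF]] by blast
      obtain s a' where s: "s \<in> ?N \<inter> ?G" "a' \<in> A'" "g = s \<oplus>\<^bsub>V\<^esub> a'" using bspec[OF split gG] by blast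
      have car: "s \<in> carrier V" "a' \<in> carrier V" "b \<in> carrier W" "T s = \<zero>\<^bsub>W\<^esub>"
        using s(1) V.subspace_carrier[OF A'(1) s(2)] W.subspace_carrier[OF B ab(2)] by auto
      have Ta: "T a' = a" using g(2) s(3) car by simp
      \<comment> \<open>Removing the lift \<open>a'\<close> of the \<open>A\<close>-component of
        \<open>T v\<close> leaves a vector over \<open>B\<close>.\<close>
      have "T (v \<ominus>\<^bsub>V\<^esub> a') = b"
        using ab(3) car v Ta[symmetric]
        by (simp add: W.add_minus_cancel_left)
      then have "v \<ominus>\<^bsub>V\<^esub> a' \<in> ?B" using ab(2) car v by simp
      moreover have "v = a' \<oplus>\<^bsub>V\<^esub> (v \<ominus>\<^bsub>V\<^esub> a')"
        using car v by (simp add: V.add_minus_inverse)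
      ultimately show "\<exists>a\<in>A'. \<exists>b\<in>?B. v = a \<oplus>\<^bsub>V\<^esub> b" using s(2) by blast
    qed
    moreover have "compatible \<F> A' ?B"
      unfolding compatible_def
    proof
      fix F assume F: "F \<in> \<F>"
      show "A' \<subseteq> F \<or> F \<subseteq> ?B"
      proof (cases "M \<subseteq> F")
        case True
        then show ?thesis using A'(2) by blast
      next
        case False
        \<comment> \<open>By minimality of \<open>M\<close>, the image of such an \<open>F\<close>
          does not contain \<open>A\<close>, so compatibility below puts it into
          \<open>B\<close>.\<close>
        then have "F \<subseteq> M" "F \<noteq> M" using F MF chain unfolding subspace_chain_def by blast+
        then have "\<not> A \<subseteq> T ` F" using M(2)[of F] F by blast
        then have "T ` F \<subseteq> B" using compat'[OF F] by blast
        then show ?thesis using V.subspace_carrier[OF sub[OF F]] by blast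
      qed
    qed
    moreover have "T ` A' \<subseteq> A" using A'(2) by blast
    moreover have "T ` ?B \<subseteq> B" by blast
    ultimately show thesis using that by blast
  qed
qed

text \<open>By rank-nullity an injective map would have rank \<open>V.dim\<close>, more than the
  dimension of its target.\<close>

lemma kernel_nonzero:
  assumes "V.fin_dim" "W.fin_dim" "W.dim < V.dim"
  shows "{v \<in> carrier V. T v \<in> {\<zero>\<^bsub>W\<^esub>}} \<noteq> {\<zero>\<^bsub>V\<^esub>}"
proof
  assume "{v \<in> carrier V. T v \<in> {\<zero>\<^bsub>W\<^esub>}} = {\<zero>\<^bsub>V\<^esub>}"
  then have "carrier (V.vs kerT) = {\<zero>\<^bsub>V\<^esub>}" by (simp add: ker_def)
  then have "inj_on T (carrier V)" by (rule Ke0_imp_inj)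
  then have "vectorspace.dim K (V.vs kerT) = 0" by (rule inj_imp_dim_ker0)
  then have "vectorspace.dim K (W.vs imT) = V.dim" using rank_nullity[OF assms(1)] by simp
  moreover have "vectorspace.dim K (W.vs imT) \<le> W.dim"
    by (rule W.subspace_dim[OF imT_is_subspace assms(2) W.subspace_fin_dim[OF assms(2) imT_is_subspace]])
  ultimately show False using assms(3) by simp
qed

text \<open>By rank-nullity the rank is at most \<open>V.dim\<close>.\<close>

lemma image_proper:
  assumes "V.fin_dim" "V.dim < W.dim"
  shows "T ` carrier V \<noteq> carrier W"
proof
  assume "T ` carrier V = carrier W"
  then have "imT = carrier W" by (rule surj_imp_imT_carrier)
  then show False using rank_nullity[OF assms(1)] assms(2) by simp
qed

end

section \<open>Representations of an oriented one-sided infinite path\<close>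

text \<open>The flag \<open>fwd k\<close> records the orientation of the edge between
  \<open>k\<close> and \<open>Suc k\<close>, and \<open>T k\<close> is its map in whichever
  direction it points.\<close>

locale A_infinity_representation =
  fixes K :: "('f, 'k) ring_scheme"
    and N :: "nat \<Rightarrow> ('f, 'v) module"
    and fwd :: "nat \<Rightarrow> bool"
    and T :: "nat \<Rightarrow> 'v \<Rightarrow> 'v"
  assumes vectorspace_N: "vectorspace K (N k)"
    and fin_dim_N: "vectorspace.fin_dim K (N k)"
    and linear_fwd: "fwd k \<Longrightarrow> linear_map K (N k) (N (Suc k)) (T k)"
    and linear_bwd: "\<not> fwd k \<Longrightarrow> linear_map K (N (Suc k)) (N k) (T k)"
begin

text \<open>The subspaces of \<open>N k\<close> obtained from \<open>0\<close> or a whole space somewhere to the right by pulling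
  back along the arrows. A decomposition of \<open>N k\<close> can only extend to the right if it is compatible
  with all of them.\<close>

inductive flag :: "nat \<Rightarrow> 'v set \<Rightarrow> bool" where
  flag_zero: "flag k {\<zero>\<^bsub>N k\<^esub>}"
| flag_whole: "flag k (carrier (N k))"
| flag_vimage: "flag (Suc k) F \<Longrightarrow> fwd k \<Longrightarrow> flag k {v \<in> carrier (N k). T k v \<in> F}"
| flag_image: "flag (Suc k) F \<Longrightarrow> \<not> fwd k \<Longrightarrow> flag k (T k ` F)"

lemma flag_subspace: "flag k F \<Longrightarrow> VectorSpace.subspace K F (N k)"
proof (induction rule: flag.induct)
  case (flag_zero k)
  show ?case by (rule vectorspace.subspace_zero_set[OF vectorspace_N])
next
  case (flag_whole k)
  show ?case by (rule vectorspace.subspace_whole[OF vectorspace_N])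
next
  case (flag_vimage k F)
  show ?case by (rule linear_map.subspace_vimage[OF linear_fwd[OF flag_vimage(2)] flag_vimage(3)])
next
  case (flag_image k F)
  show ?case by (rule linear_map.subspace_image[OF linear_bwd[OF flag_image(2)] flag_image(3)])
qed

text \<open>Apart from zero and the whole space, both members arise from members at
  \<open>Suc k\<close> by the same operation, because \<open>fwd k\<close> decides which one
  applies; images and preimages preserve inclusions.\<close>

lemma flag_linear: "flag k F \<Longrightarrow> flag k G \<Longrightarrow> F \<subseteq> G \<or> G \<subseteq> F"
proof (induction arbitrary: G rule: flag.induct)
  case (flag_zero k)
  have "\<zero>\<^bsub>N k\<^esub> \<in> G"
    by (rule vectorspace.subspace_zero[OF vectorspace_N flag_subspace[OF flag_zero]])
  then show ?case by simp
next
  case (flag_whole k)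
  have "G \<subseteq> carrier (N k)"
    by (rule vectorspace.subspace_subset[OF vectorspace_N flag_subspace[OF flag_whole]])
  then show ?case ..
next
  case (flag_vimage k F)
  have sub: "VectorSpace.subspace K {v \<in> carrier (N k). T k v \<in> F} (N k)"
    using flag_vimage(1,2) by (intro flag_subspace flag.flag_vimage)
  from flag_vimage(4) show ?case
  proof cases
    case flag_zero
    then show ?thesis using vectorspace.subspace_zero[OF vectorspace_N sub] by simp
  next
    case (flag_vimage F')
    then have "F \<subseteq> F' \<or> F' \<subseteq> F" using \<open>\<And>G. flag (Suc k) G \<Longrightarrow> F \<subseteq> G \<or> G \<subseteq> F\<close> by blast
    then show ?thesis using flag_vimage(1) by blast
  qed (use flag_vimage(2) in auto)
next
  case (flag_image k F)
  have sub: "VectorSpace.subspace K (T k ` F) (N k)"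
    using flag_image(1,2) by (intro flag_subspace flag.flag_image)
  from flag_image(4) show ?case
  proof cases
    case flag_zero
    then show ?thesis using vectorspace.subspace_zero[OF vectorspace_N sub] by simp
  next
    case flag_whole
    then show ?thesis using vectorspace.subspace_subset[OF vectorspace_N sub] by simp
  next
    case (flag_image F')
    then have "F \<subseteq> F' \<or> F' \<subseteq> F" using \<open>\<And>G. flag (Suc k) G \<Longrightarrow> F \<subseteq> G \<or> G \<subseteq> F\<close> by blast
    then show ?thesis using flag_image(1) by blast
  qed (use flag_image(2) in auto)
qed

lemma flag_chain: "subspace_chain K (N k) (Collect (flag k))"
  by (auto simp: subspace_chain_def flag_subspace dest: flag_linear)

definition compatible_at :: "nat \<Rightarrow> 'v set \<times> 'v set \<Rightarrow> bool" where
  "compatible_at k P \<longleftrightarrow>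
     complementary K (N k) (fst P) (snd P) \<and> compatible (Collect (flag k)) (fst P) (snd P)"

text \<open>This is the subrepresentation condition on one edge: \<open>S\<close> sits at
  \<open>k\<close> and \<open>S'\<close> at \<open>Suc k\<close>, whatever the orientation.\<close>

definition carries :: "nat \<Rightarrow> 'v set \<Rightarrow> 'v set \<Rightarrow> bool" where
  "carries k S S' \<longleftrightarrow> (if fwd k then T k ` S \<subseteq> S' else T k ` S' \<subseteq> S)"

text \<open>The flag at \<open>Suc k\<close>, pulled back along the edge, is part of the flag at
  \<open>k\<close>, so compatibility at \<open>k\<close> is the hypothesis for pushing or pulling
  the pair.\<close>

lemma compatible_at_step:
  assumes "compatible_at k P"
  shows "\<exists>P'. compatible_at (Suc k) P' \<and> carries k (fst P) (fst P') \<and> carries k (snd P) (snd P')"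
proof -
  have comp: "complementary K (N k) (fst P) (snd P)"
    and compat: "compatible (Collect (flag k)) (fst P) (snd P)"
    using assms by (simp_all add: compatible_at_def)
  show ?thesis
  proof (cases "fwd k")
    case True
    have "compatible ((\<lambda>F. {v \<in> carrier (N k). T k v \<in> F}) ` Collect (flag (Suc k))) (fst P) (snd P)"
      using compat True flag_vimage by (auto simp: compatible_def)
    from linear_map.complementary_push[OF linear_fwd[OF True] comp this flag_chain]
    obtain A' B' where "complementary K (N (Suc k)) A' B'" "compatible (Collect (flag (Suc k))) A' B'"
      "T k ` fst P \<subseteq> A'" "T k ` snd P \<subseteq> B'"
      using flag_zero by blast
    then show ?thesis using True by (intro exI[of _ "(A', B')"]) (simp add: compatible_at_def carries_def)
  next
    case False
    have "compatible ((\<lambda>F. T k ` F) ` Collect (flag (Suc k))) (fst P) (snd P)"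
      using compat False flag_image by (auto simp: compatible_def)
    from linear_map.complementary_pull[OF linear_bwd[OF False] fin_dim_N comp this flag_chain]
    obtain A' B' where "complementary K (N (Suc k)) A' B'" "compatible (Collect (flag (Suc k))) A' B'"
      "T k ` A' \<subseteq> fst P" "T k ` B' \<subseteq> snd P"
      using flag_whole by blast
    then show ?thesis using False by (intro exI[of _ "(A', B')"]) (simp add: compatible_at_def carries_def)
  qed
qed

theorem compatible_pair_extends:
  assumes "complementary K (N 0) A B" "compatible (Collect (flag 0)) A B"
  obtains As Bs where "As 0 = A" "Bs 0 = B" "\<forall>k. complementary K (N k) (As k) (Bs k)"
    "\<forall>k. carries k (As k) (As (Suc k))" "\<forall>k. carries k (Bs k) (Bs (Suc k))"
proof -
  \<comment> \<open>Dependent choice; the clause for \<open>k = 0\<close> pins the sequence to the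
    given pair.\<close>
  have "\<exists>f. \<forall>k. (compatible_at k (f k) \<and> (k = 0 \<longrightarrow> f k = (A, B))) \<and>
    (carries k (fst (f k)) (fst (f (Suc k))) \<and> carries k (snd (f k)) (snd (f (Suc k))))"
  proof (rule dependent_nat_choice)
    show "\<exists>P. compatible_at 0 P \<and> (0 = (0::nat) \<longrightarrow> P = (A, B))"
      using assms by (simp add: compatible_at_def)
  next
    fix P :: "'v set \<times> 'v set" and k
    assume "compatible_at k P \<and> (k = 0 \<longrightarrow> P = (A, B))"
    then show "\<exists>P'. (compatible_at (Suc k) P' \<and> (Suc k = 0 \<longrightarrow> P' = (A, B))) \<and>
        (carries k (fst P) (fst P') \<and> carries k (snd P) (snd P'))"
      using compatible_at_step[of k P] by auto
  qed
  then obtain f where f: "\<And>k. compatible_at k (f k)" "f 0 = (A, B)"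
    "\<And>k. carries k (fst (f k)) (fst (f (Suc k)))" "\<And>k. carries k (snd (f k)) (snd (f (Suc k)))"
    by blast
  show thesis
    by (rule that[of "fst \<circ> f" "snd \<circ> f"]) (use f in \<open>simp_all add: compatible_at_def\<close>)
qed

end

section \<open>Tails\<close>

lemma arrows_between_iff: "p \<in> arrows_between \<Omega> x y \<longleftrightarrow> p \<in> parcs \<Omega> \<and> (p = (x, y) \<or> p = (y, x))"
  by (auto simp: arrows_between_def)

lemma quiver_tail_inj: "quiver_tail \<Omega> x \<Longrightarrow> inj x"
  by (auto simp: quiver_tail_def infinite_journey_def)

lemma quiver_tail_vertex: "quiver_tail \<Omega> x \<Longrightarrow> x i \<in> pverts \<Omega>"
  by (auto simp: quiver_tail_def infinite_journey_def A_infinity_quiver_def quiver_morphism_def)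

text \<open>As \<open>x\<close> is injective, the two possible arrows are distinct pairs, and
  exactly one of them is present.\<close>

lemma quiver_tail_orientation:
  assumes "quiver_tail \<Omega> x"
  shows "(x (Suc i), x i) \<in> parcs \<Omega> \<longleftrightarrow> (x i, x (Suc i)) \<notin> parcs \<Omega>"
proof -
  have "card (arrows_between \<Omega> (x i) (x (i + 1))) = 1" using assms by (simp add: quiver_tail_def)
  then obtain p where "arrows_between \<Omega> (x i) (x (Suc i)) = {p}" by (auto simp: card_1_singleton_iff)
  then have p: "\<And>q. q \<in> parcs \<Omega> \<and> (q = (x i, x (Suc i)) \<or> q = (x (Suc i), x i)) \<longleftrightarrow> q = p"
    using arrows_between_iff by (metis singleton_iff)
  have "x i \<noteq> x (Suc i)" using injD[OF quiver_tail_inj[OF assms], of i "Suc i"] by auto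
  then show ?thesis using p by (metis prod.inject)
qed

lemma quiver_tail_adjacent:
  assumes "quiver_tail \<Omega> x" "i \<ge> 1" "y \<in> pverts \<Omega>"
    and "(x i, y) \<in> parcs \<Omega> \<or> (y, x i) \<in> parcs \<Omega>"
  obtains j where "y = x j" "j = Suc i \<or> i = Suc j"
proof -
  have ne: "arrows_between \<Omega> (x i) y \<noteq> {}" using assms(4) by (auto simp: arrows_between_def)
  then have "y \<in> range x" using assms(1-3) unfolding quiver_tail_def by blast
  then obtain j where j: "y = x j" by blast
  have "\<forall>j. j \<noteq> i + 1 \<and> i \<noteq> j + 1 \<longrightarrow> arrows_between \<Omega> (x i) (x j) = {}"
    using assms(1) by (simp add: quiver_tail_def)
  then have "j = Suc i \<or> i = Suc j" using ne j by auto
  then show thesis using j that by blast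
qed

theorem corollary4p2:
  fixes K :: "('f, 'k) ring_scheme"
    and \<Omega> :: "'q quiver"
    and x :: "nat \<Rightarrow> 'q"
    and V :: "('q, 'f, 'v) representation"
  assumes "field K"
    and "quiver \<Omega>"
    and "quiver_tail \<Omega> x"
    and "quiver_representation K \<Omega> V"
    and "locally_fin_dim K \<Omega> V"
    and "indecomposable K \<Omega> V"
    and "carrier (rspace V (x 0)) \<noteq> {\<zero>\<^bsub>rspace V (x 0)\<^esub>}"
  shows "\<not> (\<exists>n. vectorspace.dim K (rspace V (x n)) < vectorspace.dim K (rspace V (x (n + 1))))"
proof
  assume "\<exists>n. vectorspace.dim K (rspace V (x n)) < vectorspace.dim K (rspace V (x (n + 1)))"
  then obtain n where n: "vectorspace.dim K (rspace V (x n)) < vectorspace.dim K (rspace V (x (Suc n)))"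
    by auto
  note tail = assms(3)
  have vs: "vectorspace K (rspace V q)" if "q \<in> pverts \<Omega>" for q
    using quiver_representation.vectorspace_rspace[OF assms(4)] that by blast
  have fd: "vectorspace.fin_dim K (rspace V q)" if "q \<in> pverts \<Omega>" for q
    using assms(5) that by (simp add: locally_fin_dim_def)
  have lin: "linear_map K (rspace V p) (rspace V q) (rmap V (p, q))" if "(p, q) \<in> parcs \<Omega>" for p q
    by (rule quiver_representation.linear_map_rmap[OF assms(4) that])
  have ends: "p \<in> pverts \<Omega>" "q \<in> pverts \<Omega>" if "(p, q) \<in> parcs \<Omega>" for p q
    using pair_wf_digraph.in_arcsD1[OF assms(2) that] pair_wf_digraph.in_arcsD2[OF assms(2) that] by auto
  note vert = quiver_tail_vertex[OF tail] and x_eq = inj_eq[OF quiver_tail_inj[OF tail]]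
  \<comment> \<open>The ray starts at \<open>x (Suc n)\<close>, where the dimension has just grown;
    \<open>x n\<close> belongs to its outside.\<close>
  define y where "y k = x (Suc n + k)" for k
  define N where "N k = rspace V (y k)" for k
  define fwd where "fwd k \<longleftrightarrow> (y k, y (Suc k)) \<in> parcs \<Omega>" for k
  define T where "T k = rmap V (if fwd k then (y k, y (Suc k)) else (y (Suc k), y k))" for k
  have orient: "(y (Suc k), y k) \<in> parcs \<Omega> \<longleftrightarrow> \<not> fwd k" for k
    using quiver_tail_orientation[OF tail, of "Suc n + k"] by (simp add: y_def fwd_def)
  interpret A_infinity_representation K N fwd T
  proof (rule A_infinity_representation.intro)
    show "vectorspace K (N k)" "vectorspace.fin_dim K (N k)" for k
      by (simp_all add: N_def y_def vs fd vert)
    show "linear_map K (N k) (N (Suc k)) (T k)" if "fwd k" for k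
      using lin that by (simp add: N_def T_def fwd_def)
    show "linear_map K (N (Suc k)) (N k) (T k)" if "\<not> fwd k" for k
      using lin orient[of k] that by (simp add: N_def T_def)
  qed
  have y0: "y 0 = x (Suc n)" by (simp add: y_def)
  have vs0: "vectorspace K (N 0)" and fd0: "vectorspace.fin_dim K (N 0)"
    by (rule vectorspace_N, rule fin_dim_N)
  have whole0: "carrier (N 0) \<in> Collect (flag 0)" using flag_whole by simp
  \<comment> \<open>The last two clauses are the conditions on the edge to \<open>x n\<close>, where
    the first summand will be zero and the second the whole space.\<close>
  have "\<exists>A B. complementary K (N 0) A B \<and> compatible (Collect (flag 0)) A B \<and> A \<noteq> {\<zero>\<^bsub>N 0\<^esub>} \<and>
    ((x n, y 0) \<in> parcs \<Omega> \<longrightarrow> rmap V (x n, y 0) ` carrier (rspace V (x n)) \<subseteq> B) \<and>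
    ((y 0, x n) \<in> parcs \<Omega> \<longrightarrow> rmap V (y 0, x n) ` A \<subseteq> {\<zero>\<^bsub>rspace V (x n)\<^esub>})"
  proof (cases "(x n, y 0) \<in> parcs \<Omega>")
    case True
    then have no: "(y 0, x n) \<notin> parcs \<Omega>" using quiver_tail_orientation[OF tail, of n] by (simp add: y0)
    interpret f: linear_map K "rspace V (x n)" "N 0" "rmap V (x n, y 0)"
      using lin[OF True] by (simp add: N_def)
    have "rmap V (x n, y 0) ` carrier (rspace V (x n)) \<noteq> carrier (N 0)"
      by (rule f.image_proper[OF fd[OF vert]]) (use n in \<open>simp add: N_def y0\<close>)
    from vectorspace.compatible_summand_containing[OF vs0 fd0 flag_chain whole0
        f.subspace_image[OF f.V.subspace_whole] this]
    show ?thesis using no by metis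
  next
    case False
    then have arr: "(y 0, x n) \<in> parcs \<Omega>" using quiver_tail_orientation[OF tail, of n] by (simp add: y0)
    interpret f: linear_map K "N 0" "rspace V (x n)" "rmap V (y 0, x n)"
      using lin[OF arr] by (simp add: N_def)
    let ?I = "{v \<in> carrier (N 0). rmap V (y 0, x n) v \<in> {\<zero>\<^bsub>rspace V (x n)\<^esub>}}"
    have "?I \<noteq> {\<zero>\<^bsub>N 0\<^esub>}"
      by (rule f.kernel_nonzero[OF fd0 fd[OF vert]]) (use n in \<open>simp add: N_def y0\<close>)
    from vectorspace.compatible_summand_inside[OF vs0 fd0 flag_chain whole0
        f.subspace_vimage[OF f.W.subspace_zero_set] this]
    obtain A B where "complementary K (N 0) A B" "compatible (Collect (flag 0)) A B"
      "A \<subseteq> ?I" "A \<noteq> {\<zero>\<^bsub>N 0\<^esub>}" .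
    then show ?thesis using False by blast
  qed
  then obtain A B where AB: "complementary K (N 0) A B" "compatible (Collect (flag 0)) A B"
    and A_ne: "A \<noteq> {\<zero>\<^bsub>N 0\<^esub>}"
    and into: "(x n, y 0) \<in> parcs \<Omega> \<Longrightarrow> rmap V (x n, y 0) ` carrier (rspace V (x n)) \<subseteq> B"
    and outof: "(y 0, x n) \<in> parcs \<Omega> \<Longrightarrow> rmap V (y 0, x n) ` A \<subseteq> {\<zero>\<^bsub>rspace V (x n)\<^esub>}"
    by metis
  obtain As Bs where start: "As 0 = A" "Bs 0 = B"
    and comp: "\<forall>k. complementary K (N k) (As k) (Bs k)"
    and resp: "\<forall>k. carries k (As k) (As (Suc k))" "\<forall>k. carries k (Bs k) (Bs (Suc k))"
    by (rule compatible_pair_extends[OF AB])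
  have subs: "VectorSpace.subspace K (As k) (N k)" "VectorSpace.subspace K (Bs k) (N k)" for k
    using comp by (simp_all add: complementary_def)
  have "inj y" by (simp add: y_def inj_def x_eq)
  define U where "U q = (if q \<in> range y then As (inv_into UNIV y q) else {\<zero>\<^bsub>rspace V q\<^esub>})" for q
  define W where "W q = (if q \<in> range y then Bs (inv_into UNIV y q) else carrier (rspace V q))" for q
  have U_y: "U (y k) = As k" and W_y: "W (y k) = Bs k" for k
    using \<open>inj y\<close> by (simp_all add: U_def W_def)
  have U_out: "U q = {\<zero>\<^bsub>rspace V q\<^esub>}" and W_out: "W q = carrier (rspace V q)" if "q \<notin> range y" for q
    using that by (simp_all add: U_def W_def)
  have compl: "complementary K (rspace V q) (U q) (W q)" if "q \<in> pverts \<Omega>" for q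
  proof (cases "q \<in> range y")
    case True
    then obtain k where "q = y k" by blast
    then show ?thesis using comp by (simp add: U_y W_y flip: N_def)
  next
    case False
    then show ?thesis using vectorspace.complementary_zero_whole[OF vs[OF that]] by (simp add: U_out W_out)
  qed
  \<comment> \<open>Since \<open>Suc n + k\<close> is at least 1,
    \<open>quiver_tail_adjacent\<close> applies to every vertex of the ray; the only edge leaving
    the ray joins \<open>y 0\<close> to \<open>x n\<close>.\<close>
  have adj: "(\<exists>k. {p, q} = {y k, y (Suc k)}) \<or> (p = y 0 \<and> q = x n)"
    if p: "p \<in> range y" and pq: "(p, q) \<in> parcs \<Omega> \<or> (q, p) \<in> parcs \<Omega>" for p q
  proof -
    obtain k where k: "p = y k" using p by blast
    have "q \<in> pverts \<Omega>" using pq ends by blast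
    from quiver_tail_adjacent[OF tail _ this, of "Suc n + k"] pq k
    obtain j where j: "q = x j" "j = Suc (Suc n + k) \<or> Suc n + k = Suc j"
      by (auto simp: y_def)
    from j(2) show ?thesis
    proof
      assume "j = Suc (Suc n + k)"
      then have "q = y (Suc k)" using j(1) by (simp add: y_def)
      then show ?thesis using k by blast
    next
      assume "Suc n + k = Suc j"
      then have jk: "j = n + k" by simp
      show ?thesis
      proof (cases k)
        case 0
        then show ?thesis using k j(1) jk by simp
      next
        case (Suc k')
        then have "q = y k'" using j(1) jk by (simp add: y_def)
        then show ?thesis using k Suc by blast
      qed
    qed
  qed
  have xn_out: "x n \<notin> range y" by (auto simp: y_def x_eq)
  have step: "rmap V (p, q) ` U p \<subseteq> U q \<and> rmap V (p, q) ` W p \<subseteq> W q" if arr: "(p, q) \<in> parcs \<Omega>" for p q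
  proof -
    interpret f: linear_map K "rspace V p" "rspace V q" "rmap V (p, q)" by (rule lin[OF arr])
    have U_zero: "rmap V (p, q) ` {\<zero>\<^bsub>rspace V p\<^esub>} \<subseteq> U q"
      using compl[OF ends(2)[OF arr]] f.W.subspace_zero by (simp add: complementary_def)
    have W_in: "rmap V (p, q) ` W p \<subseteq> carrier (rspace V q)"
      using compl[OF ends(1)[OF arr]] f.V.subspace_carrier by (auto simp: complementary_def)
    consider k where "{p, q} = {y k, y (Suc k)}" | "p = y 0" "q = x n" | "q = y 0" "p = x n"
      | "p \<notin> range y" "q \<notin> range y"
      using adj[of p q] adj[of q p] arr by (metis insert_commute)
    then show ?thesis
    proof cases
      case 1
      then consider "p = y k" "q = y (Suc k)" | "p = y (Suc k)" "q = y k" by (auto simp: doubleton_eq_iff)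
      then show ?thesis
      proof cases
        case 1
        then have "fwd k" using arr by (simp add: fwd_def)
        then show ?thesis using 1 resp[rule_format, of k] by (simp add: U_y W_y carries_def T_def)
      next
        case 2
        then have "\<not> fwd k" using arr orient by simp
        then show ?thesis using 2 resp[rule_format, of k] by (simp add: U_y W_y carries_def T_def)
      qed
    next
      \<comment> \<open>Only \<open>U\<close> needs the choice of \<open>A\<close> here, as
        \<open>W\<close> is everything at \<open>x n\<close>. In the next case only \<open>W\<close>
        needs the choice of \<open>B\<close>, as \<open>U\<close> is zero there.\<close>
      case 2
      then show ?thesis using outof arr W_in xn_out start by (simp add: U_y U_out W_out)
    next
      case 3
      then show ?thesis using into arr U_zero xn_out start by (simp add: W_y U_out W_out)
    next
      case 4
      then show ?thesis using U_zero W_in by (simp add: U_out W_out)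
    qed
  qed
  have "subrepresentation K \<Omega> V U" "subrepresentation K \<Omega> V W"
    using compl by (auto simp: subrepresentation_def complementary_def image_subset_iff dest: step)
  moreover have "is_direct_sum \<Omega> V U W"
    using compl by (auto simp: is_direct_sum_def complementary_def)
  moreover have "nonzero_on \<Omega> V U"
    unfolding nonzero_on_def
    by (rule bexI[of _ "y 0"]) (use A_ne start vert U_y[of 0] in \<open>simp_all add: N_def y0\<close>)
  \<comment> \<open>The ray begins at index \<open>Suc n\<close>, so at \<open>x 0\<close> the
    summand \<open>W\<close> is the whole nonzero space.\<close>
  moreover have "x 0 \<notin> range y" by (auto simp: y_def x_eq)
  then have "nonzero_on \<Omega> V W"
    unfolding nonzero_on_def by (intro bexI[of _ "x 0"]) (use assms(7) vert in \<open>simp_all add: W_out\<close>)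
  ultimately show False using assms(6) unfolding indecomposable_def by blast
qed

end
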